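(* Let $r\ge 1$ and let $X^\star$ denote a global solution of the rank-constrained problem (SDP-$r$) with $\operatorname{tr}(X^\star)<R^2$. Then any dual multipliers $y=(y_0,\{y_{k,1},y_{k,2}\}_{k=1}^{\ell-1})$ and $z=(z_0,\{z_k\}_{k=1}^{\ell-1})$ that satisfy $y\ge 0$ (componentwise) provide the lower bound $$\phi[c]\ \ge\ \phi_r[c]\ \ge\ z_0+R^2\cdot\min\{0,\lambda_{\min}[S(y,z)]\}.$$
   Context: Data: $\ell\ge 2$; layer sizes $n_1,\dots,n_\ell$ with $n=\sum_{k=1}^\ell n_k$; $W_k\in\mathbb{R}^{n_{k+1}\times n_k}$ and $b_k\in\mathbb{R}^{n_{k+1}}$ for $k=1,\dots,\ell-1$; $w_\ell\in\mathbb{R}^{n_\ell}$ (in the application $w_\ell=W_\ell^T(\mathbf{e}_{\hat c}-\mathbf{e}_c)$ for true class $\hat c$ and target class $c$; the constant $w_0=(\mathbf{e}_{\hat c}-\mathbf{e}_c)^Tb_\ell$ is taken to be $0$); $\hat x\in\mathbb{R}^{n_1}$; radius $\rho$; trace bound $R>0$. $\|\cdot\|$ is the Euclidean norm; inequalities between vectors are componentwise; $\operatorname{diag}$ of a matrix is its diagonal as a vector and $\operatorname{diag}$ of a vector is the diagonal matrix. Attack problem (A): $\phi[c]=\min w_\ell^Tx_\ell$ over $x_k\in\mathbb{R}^{n_k}$ ($k=1,\dots,\ell$) subject to $x_{k+1}=\max\{0,W_kx_k+b_k\}$ for $k=1,\dots,\ell-1$ and $\|x_1-\hat x\|\le\rho$.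 Problem (SDP-$r$), $1\le r\le n+1$: $\phi_r[c]=\min w_\ell^Tx_\ell$ over symmetric positive semidefinite $(n+1)\times(n+1)$ matrices $$X=\begin{bmatrix}x_0&x_1^T&\cdots&x_\ell^T\\ x_1&X_{1,1}&\cdots&X_{1,\ell}\\ \vdots&\vdots&\ddots&\vdots\\ x_\ell&X_{1,\ell}^T&\cdots&X_{\ell,\ell}\end{bmatrix}\succeq0,\qquad \operatorname{rank}(X)\le r$$ (with $x_0\in\mathbb{R}$, $x_k\in\mathbb{R}^{n_k}$, $X_{i,j}\in\mathbb{R}^{n_i\times n_j}$) subject to $\operatorname{tr}(X_{1,1})-2x_1^T\hat x+\|\hat x\|^2x_0\le\rho^2x_0$; and, for all $k\in\{1,\dots,\ell-1\}$, $x_{k+1}\ge0$, $x_{k+1}\ge W_kx_k+b_kx_0$, $\operatorname{diag}(X_{k+1,k+1}-W_kX_{k,k+1}-b_kx_{k+1}^T)=0$; and $x_0=1$, $\operatorname{tr}(X)\le R^2$. Standing assumption: $R$ is chosen large enough that $\operatorname{tr}(X^\star)<R^2$ holds at optimality, and so that the rank-one instance coincides with (A), i.e. $\phi_1[c]=\phi[c]$. Dual multipliers: $y_0\in\mathbb{R}$, $y_{k,1},y_{k,2}\in\mathbb{R}^{n_{k+1}}$, $z_0\in\mathbb{R}$, $z_k\in\mathbb{R}^{n_{k+1}}$. The slack matrix $S(y,z)$ is the symmetric $(n+1)\times(n+1)$ matrix $$S(y,z)=\frac12\begin{bmatrix}s_0&s_1^T&s_2^T&\cdots&s_\ell^T\\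 s_1&S_{1,1}&S_{1,2}&&\\ s_2&S_{1,2}^T&S_{2,2}&\ddots&\\ \vdots&&\ddots&\ddots&S_{\ell-1,\ell}\\ s_\ell&&&S_{\ell-1,\ell}^T&S_{\ell,\ell}\end{bmatrix}$$ (blank blocks zero), where, with $Z_k=\operatorname{diag}(z_k)$, $s_0=2[y_0(\|\hat x\|^2-\rho^2)+\sum_{k=1}^{\ell-1}b_k^Ty_{k,2}-z_0]$, $s_1=W_1^Ty_{1,2}-2\hat xy_0$, $s_{k+1}=W_{k+1}^Ty_{k+1,2}-(Z_kb_k+y_{k,1}+y_{k,2})$ for $k\in\{1,\dots,\ell-2\}$, $s_\ell=w_\ell-[Z_{\ell-1}b_{\ell-1}+y_{\ell-1,1}+y_{\ell-1,2}]$, $S_{1,1}=2y_0I$, and $S_{k,k+1}=-W_k^TZ_k$, $S_{k+1,k+1}=2Z_k$ for $k\in\{1,\dots,\ell-1\}$. $\lambda_{\min}$ is the smallest eigenvalue. *)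

theory Defs
  imports
    "Jordan_Normal_Form.Matrix"
    "Jordan_Normal_Form.DL_Rank"
    "Jordan_Normal_Form.Spectral_Radius"
    "HOL-Library.Extended_Real"
begin

section \<open>Vectors and matrices\<close>

definition vnorm :: "real vec \<Rightarrow> real" where
  "vnorm v = sqrt (v \<bullet> v)"

definition relu :: "real vec \<Rightarrow> real vec" where
  "relu v = map_vec (max 0) v"

definition vec_diag :: "real vec \<Rightarrow> real mat" where
  "vec_diag v = mat_diag (dim_vec v) (\<lambda>i. v $ i)"

definition diag_vec :: "real mat \<Rightarrow> real vec" where
  "diag_vec A = vec_of_list (diag_mat A)"

definition outer :: "real vec \<Rightarrow> real vec \<Rightarrow> real mat" where
  "outer u v = mat (dim_vec u) (dim_vec v) (\<lambda>(i, j). u $ i * v $ j)"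

definition mat_trace :: "real mat \<Rightarrow> real" where
  "mat_trace A = (\<Sum>i<dim_row A. A $$ (i, i))"

definition psd :: "nat \<Rightarrow> real mat \<Rightarrow> bool" where
  "psd m A \<longleftrightarrow> A \<in> carrier_mat m m \<and> A\<^sup>T = A \<and> (\<forall>v \<in> carrier_vec m. 0 \<le> v \<bullet> (A *\<^sub>v v))"

text \<open>Meaningful for real symmetric matrices of positive size, whose spectrum is finite and nonempty.\<close>

definition lambda_min :: "real mat \<Rightarrow> real" where
  "lambda_min A = Min (spectrum A)"

section \<open>Block partition\<close>

text \<open>
  Matrices of size \<open>n + 1\<close>, with \<open>n = n\<^sub>1 + \<dots> + n\<^sub>l\<close>, are partitioned into blocks numbered
  \<open>0, \<dots>, l\<close>: block \<open>0\<close> has size one and block \<open>k \<ge> 1\<close> has size \<open>n\<^sub>k\<close>.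
\<close>

definition total :: "nat \<Rightarrow> (nat \<Rightarrow> nat) \<Rightarrow> nat" where
  "total l n = (\<Sum>k = 1..l. n k)"

definition bdim :: "(nat \<Rightarrow> nat) \<Rightarrow> nat \<Rightarrow> nat" where
  "bdim n k = (if k = 0 then 1 else n k)"

definition boff :: "(nat \<Rightarrow> nat) \<Rightarrow> nat \<Rightarrow> nat" where
  "boff n k = (\<Sum>j<k. bdim n j)"

definition block :: "(nat \<Rightarrow> nat) \<Rightarrow> real mat \<Rightarrow> nat \<Rightarrow> nat \<Rightarrow> real mat" where
  "block n X i j = mat (bdim n i) (bdim n j) (\<lambda>(p, q). X $$ (boff n i + p, boff n j + q))"

definition block_vec :: "(nat \<Rightarrow> nat) \<Rightarrow> real mat \<Rightarrow> nat \<Rightarrow> real vec" where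
  "block_vec n X k = col (block n X k 0) 0"

text \<open>The block that contains the row or column index \<open>p\<close>.\<close>

definition block_of :: "(nat \<Rightarrow> nat) \<Rightarrow> nat \<Rightarrow> nat" where
  "block_of n p = (LEAST k. p < boff n (Suc k))"

definition from_blocks :: "nat \<Rightarrow> (nat \<Rightarrow> nat) \<Rightarrow> (nat \<Rightarrow> nat \<Rightarrow> real mat) \<Rightarrow> real mat" where
  "from_blocks l n B = mat (total l n + 1) (total l n + 1)
     (\<lambda>(p, q). B (block_of n p) (block_of n q)
        $$ (p - boff n (block_of n p), q - boff n (block_of n q)))"

lemma boff_Suc: "boff n (Suc k) = boff n k + bdim n k"
  by (simp add: boff_def)

lemma boff_mono: "i \<le> j \<Longrightarrow> boff n i \<le> boff n j"
  unfolding boff_def by (rule sum_mono2) auto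

lemma boff_total: "boff n (Suc l) = total l n + 1"
  by (induction l) (simp_all add: boff_def total_def bdim_def)

lemma block_of_boff:
  assumes "p < bdim n i"
  shows "block_of n (boff n i + p) = i"
  unfolding block_of_def
proof (rule Least_equality)
  show "boff n i + p < boff n (Suc i)"
    using assms by (simp add: boff_Suc)
next
  fix k assume k: "boff n i + p < boff n (Suc k)"
  show "i \<le> k"
  proof (rule ccontr)
    assume "\<not> i \<le> k"
    then have "boff n (Suc k) \<le> boff n i"
      by (intro boff_mono) simp
    with k show False by simp
  qed
qed

lemma block_from_blocks:
  assumes "i \<le> l" "j \<le> l" "B i j \<in> carrier_mat (bdim n i) (bdim n j)"
  shows "block n (from_blocks l n B) i j = B i j"
proof -
  have lt: "boff n k + p < Suc (total l n)" if "k \<le> l" "p < bdim n k" for k p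
    using that boff_mono[of "Suc k" "Suc l" n] boff_total[of n l] boff_Suc[of n k] by simp
  show ?thesis
    using assms
    by (intro eq_matI) (auto simp: block_def from_blocks_def block_of_boff lt)
qed

section \<open>The attack problem\<close>

text \<open>
  \<open>l\<close> is the number of layers and \<open>n k\<close> the size of layer \<open>k\<close>. The families are indexed from
  \<open>1\<close>: only \<open>x k\<close> and \<open>n k\<close> for \<open>1 \<le> k \<le> l\<close>, and \<open>W k\<close> and \<open>b k\<close> for \<open>1 \<le> k < l\<close>, are relevant.
\<close>

definition attack_feasible ::
  "nat \<Rightarrow> (nat \<Rightarrow> nat) \<Rightarrow> (nat \<Rightarrow> real mat) \<Rightarrow> (nat \<Rightarrow> real vec) \<Rightarrow> real vec \<Rightarrow> real
    \<Rightarrow> (nat \<Rightarrow> real vec) set" where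
  "attack_feasible l n W b xh \<rho> = {x.
     (\<forall>k \<in> {1..l}. x k \<in> carrier_vec (n k)) \<and>
     (\<forall>k \<in> {1..<l}. x (k + 1) = relu (W k *\<^sub>v x k + b k)) \<and>
     vnorm (x 1 - xh) \<le> \<rho>}"

text \<open>Optimal values are extended reals, so that an infeasible problem has value \<open>\<infinity>\<close>.\<close>

definition attack_value ::
  "nat \<Rightarrow> (nat \<Rightarrow> nat) \<Rightarrow> (nat \<Rightarrow> real mat) \<Rightarrow> (nat \<Rightarrow> real vec) \<Rightarrow> real vec \<Rightarrow> real vec \<Rightarrow> real
    \<Rightarrow> ereal" where
  "attack_value l n W b w xh \<rho> = (INF x \<in> attack_feasible l n W b xh \<rho>. ereal (w \<bullet> x l))"

section \<open>The rank-constrained semidefinite problem\<close>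

definition sdp_feasible ::
  "nat \<Rightarrow> (nat \<Rightarrow> nat) \<Rightarrow> (nat \<Rightarrow> real mat) \<Rightarrow> (nat \<Rightarrow> real vec) \<Rightarrow> real vec \<Rightarrow> real \<Rightarrow> real
    \<Rightarrow> nat \<Rightarrow> real mat set" where
  "sdp_feasible l n W b xh \<rho> R r = {X.
     psd (total l n + 1) X \<and>
     vec_space.rank (total l n + 1) X \<le> r \<and>
     (let x0 = X $$ (0, 0); x = block_vec n X in
       mat_trace (block n X 1 1) - 2 * (x 1 \<bullet> xh) + (vnorm xh)\<^sup>2 * x0 \<le> \<rho>\<^sup>2 * x0 \<and>
       (\<forall>k \<in> {1..<l}.
          0\<^sub>v (n (k + 1)) \<le> x (k + 1) \<and>
          W k *\<^sub>v x k + x0 \<cdot>\<^sub>v b k \<le> x (k + 1) \<and>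
          diag_vec (block n X (k + 1) (k + 1) - W k * block n X k (k + 1) - outer (b k) (x (k + 1)))
            = 0\<^sub>v (n (k + 1))) \<and>
       x0 = 1) \<and>
     mat_trace X \<le> R\<^sup>2}"

definition sdp_objective :: "nat \<Rightarrow> (nat \<Rightarrow> nat) \<Rightarrow> real vec \<Rightarrow> real mat \<Rightarrow> real" where
  "sdp_objective l n w X = w \<bullet> block_vec n X l"

definition sdp_value ::
  "nat \<Rightarrow> (nat \<Rightarrow> nat) \<Rightarrow> (nat \<Rightarrow> real mat) \<Rightarrow> (nat \<Rightarrow> real vec) \<Rightarrow> real vec \<Rightarrow> real vec \<Rightarrow> real
    \<Rightarrow> real \<Rightarrow> nat \<Rightarrow> ereal" where
  "sdp_value l n W b w xh \<rho> R r =
     (INF X \<in> sdp_feasible l n W b xh \<rho> R r. ereal (sdp_objective l n w X))"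

definition sdp_solution ::
  "nat \<Rightarrow> (nat \<Rightarrow> nat) \<Rightarrow> (nat \<Rightarrow> real mat) \<Rightarrow> (nat \<Rightarrow> real vec) \<Rightarrow> real vec \<Rightarrow> real vec \<Rightarrow> real
    \<Rightarrow> real \<Rightarrow> nat \<Rightarrow> real mat \<Rightarrow> bool" where
  "sdp_solution l n W b w xh \<rho> R r X \<longleftrightarrow>
     is_arg_min (sdp_objective l n w) (\<lambda>Y. Y \<in> sdp_feasible l n W b xh \<rho> R r) X"

section \<open>The dual slack matrix\<close>

text \<open>
  The multipliers \<open>y1 k\<close>, \<open>y2 k\<close> and \<open>z k\<close> (for \<open>1 \<le> k < l\<close>) have the size of layer \<open>k + 1\<close>;
  hence \<open>s\<^sub>k\<close> for \<open>k \<ge> 2\<close> involves the multipliers with index \<open>k - 1\<close>.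
\<close>

definition slack_corner ::
  "nat \<Rightarrow> (nat \<Rightarrow> real vec) \<Rightarrow> real vec \<Rightarrow> real \<Rightarrow> real \<Rightarrow> (nat \<Rightarrow> real vec) \<Rightarrow> real \<Rightarrow> real" where
  "slack_corner l b xh \<rho> y0 y2 z0 =
     2 * (y0 * ((vnorm xh)\<^sup>2 - \<rho>\<^sup>2) + (\<Sum>k = 1..<l. b k \<bullet> y2 k) - z0)"

definition slack_vec ::
  "nat \<Rightarrow> (nat \<Rightarrow> real mat) \<Rightarrow> (nat \<Rightarrow> real vec) \<Rightarrow> real vec \<Rightarrow> real vec
    \<Rightarrow> real \<Rightarrow> (nat \<Rightarrow> real vec) \<Rightarrow> (nat \<Rightarrow> real vec) \<Rightarrow> (nat \<Rightarrow> real vec) \<Rightarrow> nat \<Rightarrow> real vec" where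
  "slack_vec l W b w xh y0 y1 y2 z k =
     (if k = 1 then (W 1)\<^sup>T *\<^sub>v y2 1 - (2 * y0) \<cdot>\<^sub>v xh
      else (if k = l then w else (W k)\<^sup>T *\<^sub>v y2 k)
             - (vec_diag (z (k - 1)) *\<^sub>v b (k - 1) + y1 (k - 1) + y2 (k - 1)))"

definition slack_block ::
  "nat \<Rightarrow> (nat \<Rightarrow> nat) \<Rightarrow> (nat \<Rightarrow> real mat) \<Rightarrow> (nat \<Rightarrow> real vec) \<Rightarrow> real vec \<Rightarrow> real vec \<Rightarrow> real
    \<Rightarrow> real \<Rightarrow> (nat \<Rightarrow> real vec) \<Rightarrow> (nat \<Rightarrow> real vec) \<Rightarrow> real \<Rightarrow> (nat \<Rightarrow> real vec)
    \<Rightarrow> nat \<Rightarrow> nat \<Rightarrow> real mat" where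
  "slack_block l n W b w xh \<rho> y0 y1 y2 z0 z i j =
     (let s = slack_vec l W b w xh y0 y1 y2 z;
          off = (\<lambda>k. - ((W k)\<^sup>T * vec_diag (z k)))
      in if i = 0 \<and> j = 0 then mat 1 1 (\<lambda>_. slack_corner l b xh \<rho> y0 y2 z0)
         else if i = 0 then mat_of_rows (n j) [s j]
         else if j = 0 then mat_of_cols (n i) [s i]
         else if i = 1 \<and> j = 1 then (2 * y0) \<cdot>\<^sub>m 1\<^sub>m (n 1)
         else if i = j then 2 \<cdot>\<^sub>m vec_diag (z (i - 1))
         else if j = i + 1 then off i
         else if i = j + 1 then (off j)\<^sup>T
         else 0\<^sub>m (n i) (n j))"

definition slack ::
  "nat \<Rightarrow> (nat \<Rightarrow> nat) \<Rightarrow> (nat \<Rightarrow> real mat) \<Rightarrow> (nat \<Rightarrow> real vec) \<Rightarrow> real vec \<Rightarrow> real vec \<Rightarrow> real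
    \<Rightarrow> real \<Rightarrow> (nat \<Rightarrow> real vec) \<Rightarrow> (nat \<Rightarrow> real vec) \<Rightarrow> real \<Rightarrow> (nat \<Rightarrow> real vec) \<Rightarrow> real mat" where
  "slack l n W b w xh \<rho> y0 y1 y2 z0 z =
     (1 / 2) \<cdot>\<^sub>m from_blocks l n (slack_block l n W b w xh \<rho> y0 y1 y2 z0 z)"

end

theory Submission
  imports Defs
begin

text \<open>
  Weak duality. The slack matrix is built so that its trace pairing with a feasible \<open>X\<close> is the
  Lagrangian minus \<open>z0\<close>; since the multipliers of the inequalities are nonnegative, the objective at
  \<open>X\<close> is at least \<open>z0\<close> plus the pairing of \<open>S(y,z)\<close> with \<open>X\<close>. As \<open>S - \<lambda>\<^sub>m\<^sub>i\<^sub>n 1\<close> and \<open>X\<close> are positive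
  semidefinite, that pairing is at least \<open>\<lambda>\<^sub>m\<^sub>i\<^sub>n tr X\<close>, and \<open>0 \<le> tr X \<le> R\<^sup>2\<close>. The first inequality
  holds because the attack problem is the rank-one case and the feasible set grows with the rank.
\<close>

section \<open>The smallest eigenvalue of a symmetric matrix\<close>

lemma quadratic_form_eq_sum:
  fixes A :: "real mat"
  assumes "A \<in> carrier_mat m m" "u \<in> carrier_vec m" "v \<in> carrier_vec m"
  shows "u \<bullet> (A *\<^sub>v v) = (\<Sum>i<m. \<Sum>j<m. A $$ (i, j) * (u $ i * v $ j))"
  using assms
  by (auto simp: scalar_prod_def lessThan_atLeast0 sum_distrib_left mult_ac intro!: sum.cong)

text \<open>A crude bound on the form by the sum of the absolute entries. The added 1 makes
  \<open>C\<close> strictly positive even for the zero matrix, so that it can be divided by.\<close>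

lemma quadratic_form_bound:
  fixes A :: "real mat"
  assumes A: "A \<in> carrier_mat m m"
  obtains C where "0 < C" "\<And>v. v \<in> carrier_vec m \<Longrightarrow> \<bar>v \<bullet> (A *\<^sub>v v)\<bar> \<le> C * (v \<bullet> v)"
proof
  define C where "C = (\<Sum>i<m. \<Sum>j<m. \<bar>A $$ (i, j)\<bar>) + 1"
  have C: "0 \<le> C - 1"
    unfolding C_def by (simp add: sum_nonneg)
  then show "0 < C"
    by simp
  fix v :: "real vec" assume v: "v \<in> carrier_vec m"
  have vv: "v \<bullet> v = (\<Sum>k<m. (v $ k)\<^sup>2)"
    using v by (simp add: scalar_prod_def lessThan_atLeast0 power2_eq_square)
  have le: "(v $ i)\<^sup>2 \<le> v \<bullet> v" if "i < m" for i
    unfolding vv using that by (intro member_le_sum) auto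
  have prod: "\<bar>v $ i * v $ j\<bar> \<le> v \<bullet> v" if "i < m" "j < m" for i j
  proof -
    have "2 * \<bar>v $ i * v $ j\<bar> \<le> (v $ i)\<^sup>2 + (v $ j)\<^sup>2"
      using sum_squares_bound[of "\<bar>v $ i\<bar>" "\<bar>v $ j\<bar>"] by (simp add: abs_mult)
    with le[OF that(1)] le[OF that(2)] show ?thesis by simp
  qed
  have "\<bar>v \<bullet> (A *\<^sub>v v)\<bar> \<le> (\<Sum>i<m. \<Sum>j<m. \<bar>A $$ (i, j) * (v $ i * v $ j)\<bar>)"
    unfolding quadratic_form_eq_sum[OF A v v]
    by (intro order_trans[OF sum_abs] sum_mono order_refl)
  also have "\<dots> \<le> (\<Sum>i<m. \<Sum>j<m. \<bar>A $$ (i, j)\<bar> * (v \<bullet> v))"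
    using prod by (intro sum_mono) (simp add: abs_mult[of "A $$ _"] mult_left_mono)
  also have "\<dots> = (C - 1) * (v \<bullet> v)"
    by (simp add: C_def sum_distrib_right)
  also have "\<dots> \<le> C * (v \<bullet> v)"
    using vv by (intro mult_right_mono) (simp_all add: sum_nonneg)
  finally show "\<bar>v \<bullet> (A *\<^sub>v v)\<bar> \<le> C * (v \<bullet> v)" .
qed

lemma symmetric_scalar_prod:
  fixes A :: "real mat"
  assumes "A \<in> carrier_mat m m" "A\<^sup>T = A" "u \<in> carrier_vec m" "v \<in> carrier_vec m"
  shows "u \<bullet> (A *\<^sub>v v) = (A *\<^sub>v u) \<bullet> v"
  using transpose_vec_mult_scalar[of A m m v u] assms by (simp add: comm_scalar_prod)

text \<open>In the Loewner order this is \<open>A * A \<le> C * A\<close>, obtained without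
  diagonalising \<open>A\<close>. It makes \<open>A *\<^sub>v v\<close> small whenever the form at
  \<open>v\<close> is small.\<close>

lemma psd_image_bound:
  assumes psd: "psd m A"
    and C: "0 < C" "\<And>v. v \<in> carrier_vec m \<Longrightarrow> \<bar>v \<bullet> (A *\<^sub>v v)\<bar> \<le> C * (v \<bullet> v)"
    and v: "v \<in> carrier_vec m"
  shows "(A *\<^sub>v v) \<bullet> (A *\<^sub>v v) \<le> C * (v \<bullet> (A *\<^sub>v v))"
proof -
  have A: "A \<in> carrier_mat m m" "A\<^sup>T = A"
    using psd by (auto simp: psd_def)
  define u where "u = A *\<^sub>v v"
  have u: "u \<in> carrier_vec m"
    using A v by (simp add: u_def)
  have Au: "A *\<^sub>v u \<in> carrier_vec m"
    using A u by simp
  have vAu: "v \<bullet> (A *\<^sub>v u) = u \<bullet> u"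
    using symmetric_scalar_prod[OF A v u] by (simp add: u_def)
  \<comment> \<open>Test the form at \<open>C v - A v\<close>, the minimising step along \<open>A v\<close> up to scaling.\<close>
  have "0 \<le> (C \<cdot>\<^sub>v v - u) \<bullet> (A *\<^sub>v (C \<cdot>\<^sub>v v - u))"
    using psd u v by (auto simp: psd_def)
  also have "A *\<^sub>v (C \<cdot>\<^sub>v v - u) = C \<cdot>\<^sub>v u - A *\<^sub>v u"
    using A u v by (simp add: mult_minus_distrib_mat_vec mult_mat_vec u_def[symmetric])
  also have "(C \<cdot>\<^sub>v v - u) \<bullet> (C \<cdot>\<^sub>v u - A *\<^sub>v u)
      = C * (C * (v \<bullet> u)) - C * (v \<bullet> (A *\<^sub>v u)) - C * (u \<bullet> u) + u \<bullet> (A *\<^sub>v u)"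
    using u v Au by (simp add: minus_scalar_prod_distrib[of _ m] scalar_prod_minus_distrib[of _ m]
        right_diff_distrib)
  \<comment> \<open>Since \<open>v \<bullet> (A *\<^sub>v u)\<close> equals
    \<open>u \<bullet> u\<close>, the bound on the form at \<open>u\<close> cancels one of the two
    terms \<open>C * (u \<bullet> u)\<close>.\<close>
  also have "\<dots> \<le> C * (C * (v \<bullet> u)) - C * (u \<bullet> u)"
    using C(2)[OF u] by (simp add: vAu)
  finally have "C * (u \<bullet> u) \<le> C * (C * (v \<bullet> u))"
    by simp
  then show ?thesis
    using C(1) unfolding u_def by simp
qed

lemma scalar_prod_self_ge_0: "0 \<le> v \<bullet> (v :: real vec)"
  by (simp add: scalar_prod_def sum_nonneg)

text \<open>
  The infimum of the Rayleigh quotient is an eigenvalue, without any compactness: were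
  \<open>M = A - \<mu> 1\<close> invertible, then \<open>psd_image_bound\<close> would bound the form of \<open>M\<close> from below by a
  positive multiple of \<open>v \<bullet> v\<close>, so that \<open>\<mu>\<close> could be increased.
\<close>

lemma symmetric_min_eigenvalue:
  fixes A :: "real mat"
  assumes A: "A \<in> carrier_mat m m" "A\<^sup>T = A" and m: "0 < m"
  obtains \<mu> where "\<mu> \<in> spectrum A" "psd m (A - \<mu> \<cdot>\<^sub>m 1\<^sub>m m)"
proof -
  define K where "K = (\<lambda>v. v \<bullet> (A *\<^sub>v v)) ` {v \<in> carrier_vec m. v \<bullet> v = 1}"
  define \<mu> where "\<mu> = Inf K"
  define M where "M = A - \<mu> \<cdot>\<^sub>m 1\<^sub>m m"
  have M: "M \<in> carrier_mat m m"
    unfolding M_def by (rule minus_carrier_mat) simp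
  obtain D where D: "0 < D" "\<And>v. v \<in> carrier_vec m \<Longrightarrow> \<bar>v \<bullet> (A *\<^sub>v v)\<bar> \<le> D * (v \<bullet> v)"
    using quadratic_form_bound[OF A(1)] by blast
  have bdd: "bdd_below K"
  proof (rule bdd_belowI)
    fix x assume "x \<in> K"
    then obtain v where "v \<in> carrier_vec m" "v \<bullet> v = 1" "x = v \<bullet> (A *\<^sub>v v)"
      by (auto simp: K_def)
    with D(2)[of v] show "- D \<le> x"
      by simp
  qed
  have ne: "K \<noteq> {}"
    unfolding K_def using m by (auto intro!: exI[of _ "unit_vec m 0"])
  have scalar: "(\<mu> \<cdot>\<^sub>m 1\<^sub>m m) *\<^sub>v v = \<mu> \<cdot>\<^sub>v v" if "v \<in> carrier_vec m" for v
    using that by (intro eq_vecI) auto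
  have form: "v \<bullet> (M *\<^sub>v v) = v \<bullet> (A *\<^sub>v v) - \<mu> * (v \<bullet> v)" if "v \<in> carrier_vec m" for v
    using that A by (simp add: scalar M_def minus_mult_distrib_mat_vec[of _ m m] scalar_prod_minus_distrib[of _ m])
  have psd: "psd m M"
    unfolding psd_def
  proof (intro conjI ballI)
    have "A $$ (i, j) = A $$ (j, i)" if "i < m" "j < m" for i j
      using A that by (metis carrier_matD index_transpose_mat(1))
    then show "M\<^sup>T = M"
      using A(1) unfolding M_def by (intro eq_matI) auto
    fix v :: "real vec" assume v: "v \<in> carrier_vec m"
    show "0 \<le> v \<bullet> (M *\<^sub>v v)"
    proof (cases "v \<bullet> v = 0")
      case True
      \<comment> \<open>No normalisation is possible here, but the bound with \<open>D\<close>
        forces the form of \<open>A\<close> to vanish at \<open>v\<close>.\<close>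
      then show ?thesis
        using D(2)[OF v] by (simp add: form[OF v])
    next
      case False
      define t where "t = 1 / sqrt (v \<bullet> v)"
      have pos: "0 < v \<bullet> v"
        using False scalar_prod_self_ge_0[of v] by simp
      then have t: "t * t = 1 / (v \<bullet> v)"
        by (simp add: t_def)
      have "(t \<cdot>\<^sub>v v) \<bullet> (A *\<^sub>v (t \<cdot>\<^sub>v v)) \<in> K"
        unfolding K_def using v t pos
        by (intro imageI) (simp add: mult.assoc[symmetric])
      then have "\<mu> \<le> (t \<cdot>\<^sub>v v) \<bullet> (A *\<^sub>v (t \<cdot>\<^sub>v v))"
        unfolding \<mu>_def using bdd by (rule cInf_lower)
      also have "\<dots> = (v \<bullet> (A *\<^sub>v v)) / (v \<bullet> v)"
        using v A t by (simp add: mult_mat_vec mult.assoc[symmetric])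
      finally show ?thesis
        using pos by (simp add: form[OF v] field_simps)
    qed
  qed (fact M)
  have "det M = 0"
  proof (rule ccontr)
    assume "det M \<noteq> 0"
    then obtain N where N: "N \<in> carrier_mat m m" "N * M = 1\<^sub>m m"
      using det_non_zero_imp_unit[OF M] M by (auto simp: Units_def ring_mat_def)
    obtain C where C: "0 < C" "\<And>v. v \<in> carrier_vec m \<Longrightarrow> \<bar>v \<bullet> (M *\<^sub>v v)\<bar> \<le> C * (v \<bullet> v)"
      using quadratic_form_bound[OF M] by blast
    obtain E where E: "0 < E" "\<And>v. v \<in> carrier_vec m \<Longrightarrow> \<bar>v \<bullet> ((N\<^sup>T * N) *\<^sub>v v)\<bar> \<le> E * (v \<bullet> v)"
      using quadratic_form_bound[of "N\<^sup>T * N" m] N by auto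
    \<comment> \<open>The gap comes from the chain
      \<open>1 = |v|^2 = |N M v|^2 \<le> E |M v|^2 \<le> E C (x - \<mu>)\<close> for unit
      \<open>v\<close>, where \<open>E\<close> bounds the squared norm of the inverse
      \<open>N\<close>.\<close>
    have "\<mu> + 1 / (E * C) \<le> Inf K"
    proof (rule cInf_greatest[OF ne])
      fix x assume "x \<in> K"
      then obtain v where v: "v \<in> carrier_vec m" "v \<bullet> v = 1" "x = v \<bullet> (A *\<^sub>v v)"
        by (auto simp: K_def)
      define u where "u = M *\<^sub>v v"
      have u: "u \<in> carrier_vec m"
        using M v by (simp add: u_def)
      have "v = N *\<^sub>v u"
        using N M v unfolding u_def by (subst assoc_mult_mat_vec[symmetric]) auto
      then have "1 = (N *\<^sub>v u) \<bullet> (N *\<^sub>v u)"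
        using v by simp
      also have "\<dots> = u \<bullet> ((N\<^sup>T * N) *\<^sub>v u)"
        using transpose_vec_mult_scalar[of "N\<^sup>T" m m "N *\<^sub>v u" u] N u
        by (simp add: assoc_mult_mat_vec[of _ m m])
      also have "\<dots> \<le> E * (u \<bullet> u)"
        using E(2)[OF u] by simp
      also have "\<dots> \<le> E * (C * (v \<bullet> (M *\<^sub>v v)))"
        using psd_image_bound[OF psd C v(1)] E(1) by (simp add: u_def)
      also have "\<dots> = E * C * (x - \<mu>)"
        using v by (simp add: form)
      finally show "\<mu> + 1 / (E * C) \<le> x"
        using E(1) C(1) by (simp add: field_simps)
    qed
    then show False
      using E(1) C(1) by (simp add: \<mu>_def[symmetric] mult_le_0_iff)
  qed
  moreover have "M = char_matrix A \<mu>"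
    using A by (auto simp: M_def char_matrix_def)
  ultimately have "\<mu> \<in> spectrum A"
    using eigenvalue_det[OF A(1)] by (simp add: spectrum_def)
  with psd that show thesis
    by (simp add: M_def)
qed

text \<open>
  Induction on the size: eliminating the last row and column of \<open>X\<close> leaves its Schur complement.
  The division by \<open>X m m\<close> is harmless when this entry vanishes, because then so does its row.
\<close>

lemma sum_psd_mult_nonneg:
  fixes M X :: "nat \<Rightarrow> nat \<Rightarrow> real"
  assumes "\<And>v. 0 \<le> (\<Sum>i<m. \<Sum>j<m. M i j * (v i * v j))"
    and "\<And>v. 0 \<le> (\<Sum>i<m. \<Sum>j<m. X i j * (v i * v j))"
    and "\<And>i j. i < m \<Longrightarrow> j < m \<Longrightarrow> X i j = X j i"
  shows "0 \<le> (\<Sum>i<m. \<Sum>j<m. M i j * X i j)"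
  using assms
proof (induction m arbitrary: X)
  case 0
  then show ?case by simp
next
  case (Suc m)
  define d where "d = X m m"
  define Y where "Y = (\<lambda>i j. X i j - X i m * X j m / d)"
  \<comment> \<open>Isolates the last variable, in which the form is a quadratic polynomial with
    leading coefficient \<open>d\<close>.\<close>
  have split: "(\<Sum>i<Suc m. \<Sum>j<Suc m. X i j * (v i * v j))
      = (\<Sum>i<m. \<Sum>j<m. X i j * (v i * v j)) + 2 * v m * (\<Sum>i<m. X i m * v i) + d * (v m)\<^sup>2" for v
  proof -
    have "(\<Sum>j<m. X m j * (v m * v j)) = v m * (\<Sum>i<m. X i m * v i)"
      using Suc.prems(3)[of m] by (auto simp: sum_distrib_left intro!: sum.cong)
    moreover have "(\<Sum>i<m. X i m * (v i * v m)) = v m * (\<Sum>i<m. X i m * v i)"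
      by (simp add: sum_distrib_left mult_ac)
    ultimately show ?thesis
      by (simp add: sum.distrib d_def power2_eq_square)
  qed
  have quad: "0 \<le> (\<Sum>i<m. \<Sum>j<m. X i j * (v i * v j)) + 2 * t * (\<Sum>i<m. X i m * v i) + d * t\<^sup>2" for v t
    using Suc.prems(2)[of "v(m := t)"] unfolding split by simp
  have d0: "0 \<le> d"
    using quad[of "\<lambda>_. 0" 1] by simp
  have row: "X i m = 0" if "d = 0" "i \<le> m" for i
  proof (rule ccontr)
    assume nz: "X i m \<noteq> 0"
    with that have i: "i < m"
      by (cases "i = m") (auto simp: d_def)
    define v :: "nat \<Rightarrow> real" where "v = (\<lambda>j. if j = i then 1 else 0)"
    define q where "q = (\<Sum>k<m. \<Sum>j<m. X k j * (v k * v j))"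
    have "X j m * v j = (if j = i then X i m else 0)" for j
      by (simp add: v_def)
    then have "(\<Sum>j<m. X j m * v j) = X i m"
      using i by simp
    with quad[of v] \<open>d = 0\<close> have "0 \<le> q + 2 * t * X i m" for t
      by (simp add: q_def)
    \<comment> \<open>With \<open>d = 0\<close> the form is affine in \<open>t\<close> with nonzero
      slope; this \<open>t\<close> gives it the value -1.\<close>
    from this[of "- (q + 1) / (2 * X i m)"] nz show False
      by (simp add: field_simps)
  qed
  \<comment> \<open>For nonzero \<open>d\<close> the subtracted term cancels the last row and column
    of \<open>X\<close>; for \<open>d = 0\<close> they vanish already by \<open>row\<close>.\<close>
  have Y0: "Y i m = 0" "Y m i = 0" if "i \<le> m" for i
    using row that Suc.prems(3)[of i m] by (auto simp: Y_def d_def field_simps)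
  have "0 \<le> (\<Sum>i<m. \<Sum>j<m. M i j * Y i j)"
  proof (rule Suc.IH)
    show "0 \<le> (\<Sum>i<m. \<Sum>j<m. M i j * (v i * v j))" for v
      using Suc.prems(1)[of "v(m := 0)"] by simp
    show "Y i j = Y j i" if "i < m" "j < m" for i j
      using that Suc.prems(3)[of i j] by (simp add: Y_def)
    fix v
    define c where "c = (\<Sum>i<m. X i m * v i)"
    have "(\<Sum>i<m. \<Sum>j<m. X i m * X j m / d * (v i * v j)) = c * c / d"
      by (simp add: c_def sum_product sum_divide_distrib mult_ac)
    then have "(\<Sum>i<m. \<Sum>j<m. Y i j * (v i * v j)) = (\<Sum>i<m. \<Sum>j<m. X i j * (v i * v j)) - c * c / d"
      by (simp add: Y_def left_diff_distrib sum_subtractf)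
    \<comment> \<open>Completing the square: \<open>t = - c / d\<close> minimises the form in the
      last variable, and the minimum is the form of the Schur complement. For \<open>d = 0\<close>
      all quotients are 0 and both sides agree.\<close>
    also have "\<dots> = (\<Sum>i<m. \<Sum>j<m. X i j * (v i * v j)) + 2 * (- c / d) * c + d * (- c / d)\<^sup>2"
      by (cases "d = 0") (simp_all add: field_simps power2_eq_square)
    also have "0 \<le> \<dots>"
      using quad[of v "- c / d"] by (simp add: c_def)
    finally show "0 \<le> (\<Sum>i<m. \<Sum>j<m. Y i j * (v i * v j))" .
  qed
  also have "\<dots> = (\<Sum>i<Suc m. \<Sum>j<Suc m. M i j * Y i j)"
    by (simp add: Y0)
  \<comment> \<open>The rank-one part removed from \<open>X\<close> is added back; its pairing with
    \<open>M\<close> is the form of \<open>M\<close> at the last column of \<open>X\<close>, divided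
    by \<open>d\<close>.\<close>
  also have "\<dots> \<le> \<dots> + (\<Sum>i<Suc m. \<Sum>j<Suc m. M i j * (X i m * X j m)) / d"
    using d0 Suc.prems(1)[of "\<lambda>i. X i m"] by (simp del: sum.lessThan_Suc)
  also have "\<dots> = (\<Sum>i<Suc m. \<Sum>j<Suc m. M i j * X i j)"
    by (simp del: sum.lessThan_Suc add: Y_def right_diff_distrib sum_subtractf sum_divide_distrib)
  finally show ?case .
qed

text \<open>The Frobenius inner product, that is, the trace of \<open>A\<^sup>T * B\<close> for
  matrices of equal size. As a double sum over entries it splits directly along blocks.\<close>

definition frob :: "real mat \<Rightarrow> real mat \<Rightarrow> real" where
  "frob A B = (\<Sum>i<dim_row A. \<Sum>j<dim_col A. A $$ (i, j) * B $$ (i, j))"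

text \<open>Passes from matrices to the index functions of \<open>sum_psd_mult_nonneg\<close>, for
  which induction on the size requires no submatrices.\<close>

lemma psd_form_sum:
  assumes "psd m A"
  shows "0 \<le> (\<Sum>i<m. \<Sum>j<m. A $$ (i, j) * (v i * v j))"
proof -
  have "0 \<le> vec m v \<bullet> (A *\<^sub>v vec m v)"
    using assms by (auto simp: psd_def)
  then show ?thesis
    using assms quadratic_form_eq_sum[of A m "vec m v" "vec m v"] by (simp add: psd_def)
qed

text \<open>One half of the self-duality of the positive semidefinite cone.\<close>

lemma frob_psd_nonneg:
  assumes "psd m A" "psd m X"
  shows "0 \<le> frob A X"
proof -
  have "X $$ (i, j) = X $$ (j, i)" if "i < m" "j < m" for i j
    using assms(2) that by (metis carrier_matD index_transpose_mat(1) psd_def)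
  then have "0 \<le> (\<Sum>i<m. \<Sum>j<m. A $$ (i, j) * X $$ (i, j))"
    by (rule sum_psd_mult_nonneg[OF psd_form_sum[OF assms(1)] psd_form_sum[OF assms(2)]])
  then show ?thesis
    using assms(1) by (auto simp: psd_def frob_def)
qed

lemma psd_trace_nonneg:
  assumes "psd m X" shows "0 \<le> mat_trace X"
proof -
  have "0 \<le> X $$ (i, i)" if "i < m" for i
  proof -
    have "0 \<le> unit_vec m i \<bullet> (X *\<^sub>v unit_vec m i)"
      using assms by (auto simp: psd_def)
    also have "\<dots> = X $$ (i, i)"
      using assms that by (auto simp: psd_def)
    finally show ?thesis .
  qed
  then show ?thesis
    using assms by (auto simp: mat_trace_def psd_def intro: sum_nonneg)
qed

lemma lambda_min_trace_le:
  assumes A: "A \<in> carrier_mat m m" "A\<^sup>T = A" and m: "0 < m" and X: "psd m X"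
  shows "lambda_min A * mat_trace X \<le> frob A X"
proof -
  obtain \<mu> where \<mu>: "\<mu> \<in> spectrum A" "psd m (A - \<mu> \<cdot>\<^sub>m 1\<^sub>m m)"
    using symmetric_min_eigenvalue[OF A m] .
  \<comment> \<open>The spectrum is finite, so its \<open>Min\<close> lies below every member; the
    nonnegative trace then preserves the inequality.\<close>
  have "lambda_min A \<le> \<mu>"
    unfolding lambda_min_def using card_finite_spectrum(1)[OF A(1)] \<mu>(1) by (rule Min_le)
  then have "lambda_min A * mat_trace X \<le> \<mu> * mat_trace X"
    using psd_trace_nonneg[OF X] by (rule mult_right_mono)
  also have "\<dots> \<le> frob A X"
  proof -
    have "0 \<le> frob (A - \<mu> \<cdot>\<^sub>m 1\<^sub>m m) X"
      by (rule frob_psd_nonneg) fact+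
    also have "\<dots> = (\<Sum>i<m. \<Sum>j<m. A $$ (i, j) * X $$ (i, j) - (if j = i then \<mu> * X $$ (i, i) else 0))"
      unfolding frob_def using A by (intro sum.cong) (auto simp: left_diff_distrib)
    also have "\<dots> = frob A X - \<mu> * mat_trace X"
      using A X by (auto simp: sum_subtractf frob_def mat_trace_def psd_def sum_distrib_left)
    finally show ?thesis by simp
  qed
  finally show ?thesis .
qed

section \<open>Sums over blocks\<close>

lemma sum_lessThan_add:
  fixes f :: "nat \<Rightarrow> 'a :: comm_monoid_add"
  shows "sum f {..<a + b} = sum f {..<a} + (\<Sum>p<b. f (a + p))"
  by (induction b) (simp_all add: add.assoc)

lemma sum_blocks:
  fixes f :: "nat \<Rightarrow> 'a :: comm_monoid_add"
  shows "(\<Sum>p<boff n (Suc l). f p) = (\<Sum>k\<le>l. \<Sum>p<bdim n k. f (boff n k + p))"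
proof (induction l)
  case 0
  then show ?case by (simp add: boff_def)
next
  case (Suc l)
  show ?case
    unfolding boff_Suc[of n "Suc l"] sum_lessThan_add Suc by simp
qed

text \<open>The blocks exhaust the index range, which complements \<open>block_of_boff\<close>: a
  matrix index may be replaced by a block number and a local index.\<close>

lemma boff_cases:
  assumes "p < boff n (Suc l)"
  obtains k q where "k \<le> l" "q < bdim n k" "p = boff n k + q"
  using assms
proof (induction l arbitrary: thesis)
  case 0
  then show ?case by (auto simp: boff_def)
next
  case (Suc l)
  show ?case
  proof (cases "p < boff n (Suc l)")
    case True
    obtain k q where "k \<le> l" "q < bdim n k" "p = boff n k + q"
      using Suc.IH[OF _ True] by blast
    then show ?thesis
      by (intro Suc.prems(1)[of k q]) auto
  next
    case False
    with Suc.prems(2) show ?thesis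
      by (intro Suc.prems(1)[of "Suc l" "p - boff n (Suc l)"]) (auto simp: boff_Suc[of n "Suc l"])
  qed
qed

lemma from_blocks_index:
  assumes "i \<le> l" "j \<le> l" "p < bdim n i" "q < bdim n j"
  shows "from_blocks l n B $$ (boff n i + p, boff n j + q) = B i j $$ (p, q)"
proof -
  have "boff n k + r < total l n + 1" if "k \<le> l" "r < bdim n k" for k r
    using that boff_mono[of "Suc k" "Suc l" n] boff_total[of n l] boff_Suc[of n k] by simp
  with assms show ?thesis
    by (simp add: from_blocks_def block_of_boff)
qed

lemma from_blocks_symmetric:
  assumes "\<And>i j. i \<le> l \<Longrightarrow> j \<le> l \<Longrightarrow> B i j \<in> carrier_mat (bdim n i) (bdim n j)"
    and "\<And>i j. i \<le> l \<Longrightarrow> j \<le> l \<Longrightarrow> B j i = (B i j)\<^sup>T"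
  shows "(from_blocks l n B)\<^sup>T = from_blocks l n B"
proof (rule eq_matI)
  fix p q
  assume "p < dim_row (from_blocks l n B)" "q < dim_col (from_blocks l n B)"
  then have pq: "p < boff n (Suc l)" "q < boff n (Suc l)"
    by (simp_all add: from_blocks_def boff_total)
  obtain i p' where i: "i \<le> l" "p' < bdim n i" "p = boff n i + p'"
    using boff_cases[OF pq(1)] .
  obtain j q' where j: "j \<le> l" "q' < bdim n j" "q = boff n j + q'"
    using boff_cases[OF pq(2)] .
  have "B j i $$ (q', p') = B i j $$ (p', q')"
    using assms(1)[OF i(1) j(1)] i j by (subst assms(2)) auto
  then have "from_blocks l n B $$ (q, p) = from_blocks l n B $$ (p, q)"
    using i j by (simp add: from_blocks_index)
  with pq show "(from_blocks l n B)\<^sup>T $$ (p, q) = from_blocks l n B $$ (p, q)"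
    by (simp add: from_blocks_def boff_total)
qed (simp_all add: from_blocks_def)

text \<open>Both index ranges are cut by \<open>sum_blocks\<close>, and the two block numbers are
  then pulled outwards by exchanging sums.\<close>

lemma frob_from_blocks:
  assumes "\<And>i j. i \<le> l \<Longrightarrow> j \<le> l \<Longrightarrow> B i j \<in> carrier_mat (bdim n i) (bdim n j)"
  shows "frob (from_blocks l n B) X = (\<Sum>i\<le>l. \<Sum>j\<le>l. frob (B i j) (block n X i j))"
proof -
  let ?F = "from_blocks l n B"
  have "frob ?F X = (\<Sum>p<boff n (Suc l). \<Sum>q<boff n (Suc l). ?F $$ (p, q) * X $$ (p, q))"
    by (simp add: frob_def from_blocks_def boff_total)
  also have "\<dots> = (\<Sum>i\<le>l. \<Sum>p<bdim n i. \<Sum>j\<le>l. \<Sum>q<bdim n j.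
      ?F $$ (boff n i + p, boff n j + q) * X $$ (boff n i + p, boff n j + q))"
    unfolding sum_blocks ..
  also have "\<dots> = (\<Sum>i\<le>l. \<Sum>p<bdim n i. \<Sum>j\<le>l. \<Sum>q<bdim n j. B i j $$ (p, q) * block n X i j $$ (p, q))"
    by (intro sum.cong refl) (simp add: from_blocks_index block_def)
  also have "\<dots> = (\<Sum>i\<le>l. \<Sum>j\<le>l. \<Sum>p<bdim n i. \<Sum>q<bdim n j. B i j $$ (p, q) * block n X i j $$ (p, q))"
    by (intro sum.cong refl sum.swap)
  also have "\<dots> = (\<Sum>i\<le>l. \<Sum>j\<le>l. frob (B i j) (block n X i j))"
    unfolding frob_def using assms[THEN carrier_matD(1)] assms[THEN carrier_matD(2)]
    by (intro sum.cong refl) auto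
  finally show ?thesis .
qed

text \<open>The sparsity pattern of the slack matrix: a full first row and column, and a tridiagonal
  remainder. Symmetry counts each off-diagonal pair twice. The induction adds the last row and
  column.\<close>

lemma sum_arrow_tridiagonal:
  fixes G :: "nat \<Rightarrow> nat \<Rightarrow> real"
  assumes "\<And>i j. i \<le> l \<Longrightarrow> j \<le> l \<Longrightarrow> G j i = G i j"
    and "\<And>i j. 1 \<le> i \<Longrightarrow> i + 1 < j \<Longrightarrow> j \<le> l \<Longrightarrow> G i j = 0"
  shows "(\<Sum>i\<le>l. \<Sum>j\<le>l. G i j)
    = G 0 0 + 2 * (\<Sum>j = 1..l. G 0 j) + (\<Sum>j = 1..l. G j j) + 2 * (\<Sum>k = 1..<l. G k (k + 1))"
  using assms
proof (induction l)
  case 0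
  then show ?case by simp
next
  case (Suc l)
  have IH: "(\<Sum>i\<le>l. \<Sum>j\<le>l. G i j)
    = G 0 0 + 2 * (\<Sum>j = 1..l. G 0 j) + (\<Sum>j = 1..l. G j j) + 2 * (\<Sum>k = 1..<l. G k (k + 1))"
    using Suc.prems by (intro Suc.IH) auto
  have row: "(\<Sum>j\<le>l. G (Suc l) j) = (\<Sum>i\<le>l. G i (Suc l))"
    using Suc.prems(1) by (intro sum.cong) auto
  \<comment> \<open>Only rows 0 and \<open>l\<close> survive. For \<open>l = 0\<close> these
    coincide, and the entry must not be counted twice.\<close>
  have column: "(\<Sum>i\<le>l. G i (Suc l)) = G 0 (Suc l) + (if l = 0 then 0 else G l (Suc l))"
  proof (cases l)
    case (Suc m)
    have "(\<Sum>i\<le>l. G i (Suc l)) = (\<Sum>i\<in>{0, l}. G i (Suc l))"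
      using Suc.prems(2) by (intro sum.mono_neutral_right) auto
    then show ?thesis
      using Suc by simp
  qed simp
  have last: "(\<Sum>k = 1..<Suc l. G k (k + 1)) = (\<Sum>k = 1..<l. G k (k + 1)) + (if l = 0 then 0 else G l (Suc l))"
    by (cases l) simp_all
  show ?case
    unfolding last by (simp add: sum.distrib IH row column)
qed

section \<open>Pairings with the individual blocks of the slack matrix\<close>

lemma block_vec_carrier: "block_vec n X k \<in> carrier_vec (bdim n k)"
  unfolding block_vec_def block_def by (intro carrier_vecI) simp

lemma block_carrier: "block n X i j \<in> carrier_mat (bdim n i) (bdim n j)"
  by (simp add: block_def)

lemma diag_vec_index: "i < dim_row A \<Longrightarrow> diag_vec A $ i = A $$ (i, i)"
  unfolding diag_vec_def diag_mat_def vec_of_list_index by simp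

lemma diag_vec_carrier: "A \<in> carrier_mat m k \<Longrightarrow> diag_vec A \<in> carrier_vec m"
  by (auto simp: diag_vec_def diag_mat_def intro: carrier_vecI)

lemma dim_diag_vec [simp]: "dim_vec (diag_vec A) = dim_row A"
  by (simp add: diag_vec_def diag_mat_def)

lemma diag_vec_minus:
  assumes "A \<in> carrier_mat m m" "B \<in> carrier_mat m m"
  shows "diag_vec (A - B) = diag_vec A - diag_vec B"
  using assms by (intro eq_vecI) (auto simp: diag_vec_index)

lemma scalar_prod_diag_vec:
  assumes "A \<in> carrier_mat m m"
  shows "v \<bullet> diag_vec A = (\<Sum>i<m. v $ i * A $$ (i, i))"
  using assms diag_vec_carrier[OF assms]
  by (auto simp: scalar_prod_def lessThan_atLeast0 diag_vec_index intro!: sum.cong)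

lemma vec_diag_mult_vec:
  assumes "u \<in> carrier_vec m" "v \<in> carrier_vec m"
  shows "vec_diag u *\<^sub>v v = vec m (\<lambda>i. u $ i * v $ i)"
proof (rule eq_vecI)
  fix i assume "i < dim_vec (vec m (\<lambda>i. u $ i * v $ i))"
  then have i: "i < m"
    by simp
  have "(if i = j then u $ j else 0) * v $ j = (if j = i then u $ i * v $ i else 0)" for j
    by simp
  then show "(vec_diag u *\<^sub>v v) $ i = vec m (\<lambda>i. u $ i * v $ i) $ i"
    using assms i by (simp add: vec_diag_def mat_diag_def scalar_prod_def)
qed (use assms in \<open>simp add: vec_diag_def mat_diag_def\<close>)

text \<open>Moves the diagonal of a rank-one matrix onto the multiplier; this is the origin of the
  term \<open>vec_diag (z k) *\<^sub>v b k\<close> in \<open>slack_vec\<close>.\<close>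

lemma diag_vec_outer:
  assumes "u \<in> carrier_vec m" "b \<in> carrier_vec m" "x \<in> carrier_vec m"
  shows "u \<bullet> diag_vec (outer b x) = (vec_diag u *\<^sub>v b) \<bullet> x"
proof -
  have "u \<bullet> diag_vec (outer b x) = (\<Sum>i<m. u $ i * outer b x $$ (i, i))"
    using assms by (intro scalar_prod_diag_vec) (simp add: outer_def)
  then show ?thesis
    using assms
    by (auto simp: vec_diag_mult_vec[of _ m] scalar_prod_def outer_def lessThan_atLeast0 intro!: sum.cong)
qed

lemma frob_transpose: "frob A\<^sup>T B\<^sup>T = frob A B" if "B \<in> carrier_mat (dim_row A) (dim_col A)"
  unfolding frob_def using that by (subst sum.swap) (auto intro!: sum.cong)

lemma block_transpose:
  assumes "X \<in> carrier_mat (total l n + 1) (total l n + 1)" "X\<^sup>T = X" "i \<le> l" "j \<le> l"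
  shows "block n X j i = (block n X i j)\<^sup>T"
proof -
  have lt: "boff n k + p < total l n + 1" if "k \<le> l" "p < bdim n k" for k p
    using that boff_mono[of "Suc k" "Suc l" n] boff_total[of n l] boff_Suc[of n k] by simp
  have "X $$ (p, q) = X $$ (q, p)" if "p < total l n + 1" "q < total l n + 1" for p q
    using assms(1,2) that by (metis carrier_matD index_transpose_mat(1))
  with lt assms(3,4) show ?thesis
    by (intro eq_matI) (auto simp: block_def)
qed

lemma frob_diag:
  assumes "v \<in> carrier_vec m" "A \<in> carrier_mat m m"
  shows "frob (vec_diag v) A = v \<bullet> diag_vec A"
proof -
  have "frob (vec_diag v) A = (\<Sum>i<m. \<Sum>j<m. if j = i then v $ i * A $$ (i, i) else 0)"
    unfolding frob_def using assms by (intro sum.cong) (auto simp: vec_diag_def mat_diag_def)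
  then show ?thesis
    by (simp add: scalar_prod_diag_vec[OF assms(2)])
qed

text \<open>Accounts for the off-diagonal slack blocks: up to sign, they represent the product term
  of the diagonal constraint weighted by \<open>z k\<close>.\<close>

lemma frob_transpose_mult_diag:
  assumes "v \<in> carrier_vec m" "A \<in> carrier_mat m k" "B \<in> carrier_mat k m"
  shows "frob (A\<^sup>T * vec_diag v) B = v \<bullet> diag_vec (A * B)"
proof -
  have "frob (A\<^sup>T * vec_diag v) B = (\<Sum>p<k. \<Sum>q<m. v $ q * (A $$ (q, p) * B $$ (p, q)))"
    unfolding frob_def using assms
    by (intro sum.cong) (auto simp: vec_diag_def mat_diag_mult_right[of _ k m])
  also have "\<dots> = (\<Sum>q<m. v $ q * (\<Sum>p<k. A $$ (q, p) * B $$ (p, q)))"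
    unfolding sum_distrib_left by (rule sum.swap)
  also have "\<dots> = v \<bullet> diag_vec (A * B)"
    using assms
    by (subst scalar_prod_diag_vec[of _ m])
      (auto simp: scalar_prod_def lessThan_atLeast0 intro!: sum.cong)
  finally show ?thesis .
qed


lemma frob_smult: "frob (c \<cdot>\<^sub>m A) B = c * frob A B"
  by (simp add: frob_def sum_distrib_left mult.assoc)

lemma frob_uminus: "frob (- A) B = - frob A B"
  by (simp add: frob_def sum_negf)

lemma frob_one:
  assumes "A \<in> carrier_mat m m"
  shows "frob (1\<^sub>m m) A = mat_trace A"
proof -
  have "frob (1\<^sub>m m) A = (\<Sum>i<m. \<Sum>j<m. if j = i then A $$ (i, i) else 0)"
    unfolding frob_def by (intro sum.cong) auto
  then show ?thesis
    using assms by (auto simp: mat_trace_def)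
qed

text \<open>Symmetry of \<open>X\<close> enters because \<open>block_vec\<close> is read off the
  first column, whereas the pairing runs over the first row.\<close>

lemma frob_row_block:
  assumes "v \<in> carrier_vec (bdim n k)" "k \<le> l"
    and X: "X \<in> carrier_mat (total l n + 1) (total l n + 1)" "X\<^sup>T = X"
  shows "frob (mat_of_rows (bdim n k) [v]) (block n X 0 k) = v \<bullet> block_vec n X k"
proof -
  have "block n X 0 k $$ (0, q) = block_vec n X k $ q" if "q < bdim n k" for q
    using that block_transpose[OF X, of k 0] block_carrier[of n X k 0] assms(2)
    by (simp add: block_vec_def bdim_def)
  then show ?thesis
    using assms(1) block_vec_carrier[of n X k]
    by (auto simp: frob_def scalar_prod_def lessThan_atLeast0 mat_of_rows_def intro!: sum.cong)
qed

text \<open>Turns a sum over the \<open>l\<close> layers into one over the \<open>l - 1\<close>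
  transitions by splitting off the input layer; \<open>sum_split_last\<close> splits off the output
  layer instead.\<close>

lemma sum_split_first:
  fixes f :: "nat \<Rightarrow> 'a :: comm_monoid_add"
  assumes "1 \<le> l"
  shows "(\<Sum>j = 1..l. f j) = f 1 + (\<Sum>k = 1..<l. f (k + 1))"
  using assms by (induction l rule: dec_induct) (simp_all add: add.assoc)

lemma sum_split_last:
  fixes f :: "nat \<Rightarrow> 'a :: comm_monoid_add"
  assumes "1 \<le> l"
  shows "(\<Sum>j = 1..l. f j) = (\<Sum>k = 1..<l. f k) + f l"
  using assms by (cases l) (simp_all add: atLeastLessThanSuc_atLeastAtMost)

section \<open>The Lagrangian identity\<close>

text \<open>Fixes dimensions only. The Lagrangian identity is linear in the multipliers, so their
  signs enter later, in the bound itself.\<close>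

locale multipliers =
  fixes l :: nat and n :: "nat \<Rightarrow> nat"
    and W :: "nat \<Rightarrow> real mat" and b :: "nat \<Rightarrow> real vec" and w xh :: "real vec" and \<rho> :: real
    and y0 :: real and y1 y2 :: "nat \<Rightarrow> real vec" and z0 :: real and z :: "nat \<Rightarrow> real vec"
  assumes l: "2 \<le> l"
    and W: "\<And>k. k \<in> {1..<l} \<Longrightarrow> W k \<in> carrier_mat (n (k + 1)) (n k)"
    and b: "\<And>k. k \<in> {1..<l} \<Longrightarrow> b k \<in> carrier_vec (n (k + 1))"
    and w: "w \<in> carrier_vec (n l)"
    and xh: "xh \<in> carrier_vec (n 1)"
    and y1: "\<And>k. k \<in> {1..<l} \<Longrightarrow> y1 k \<in> carrier_vec (n (k + 1))"
    and y2: "\<And>k. k \<in> {1..<l} \<Longrightarrow> y2 k \<in> carrier_vec (n (k + 1))"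
    and z: "\<And>k. k \<in> {1..<l} \<Longrightarrow> z k \<in> carrier_vec (n (k + 1))"
begin

abbreviation "s \<equiv> slack_vec l W b w xh y0 y1 y2 z"
abbreviation "B \<equiv> slack_block l n W b w xh \<rho> y0 y1 y2 z0 z"
abbreviation "S \<equiv> slack l n W b w xh \<rho> y0 y1 y2 z0 z"

lemma vec_diag_carrier: "k \<in> {1..<l} \<Longrightarrow> vec_diag (z k) \<in> carrier_mat (n (k + 1)) (n (k + 1))"
  using z[of k] by (auto simp: vec_diag_def mat_diag_def)

lemma transpose_W_y2_carrier: "k \<in> {1..<l} \<Longrightarrow> (W k)\<^sup>T *\<^sub>v y2 k \<in> carrier_vec (n k)"
  using W[of k] y2[of k] by (intro mult_mat_vec_carrier) auto

lemma slack_vec_carrier: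
  assumes "k \<in> {1..l}"
  shows "s k \<in> carrier_vec (n k)"
proof (cases "k = 1")
  case True
  then show ?thesis
    using l transpose_W_y2_carrier[of 1] xh by (simp add: slack_vec_def)
next
  case False
  \<comment> \<open>The transition into layer \<open>k\<close>, whose index its multipliers
    carry.\<close>
  define j where "j = k - 1"
  have j: "j \<in> {1..<l}" "k = j + 1"
    using False assms by (auto simp: j_def)
  have "vec_diag (z j) *\<^sub>v b j + y1 j + y2 j \<in> carrier_vec (n k)"
    using vec_diag_carrier[OF j(1)] b[OF j(1)] y1[OF j(1)] y2[OF j(1)] j(2) by simp
  moreover have "(if k = l then w else (W k)\<^sup>T *\<^sub>v y2 k) \<in> carrier_vec (n k)"
    using w transpose_W_y2_carrier[of k] assms by auto
  ultimately have "(if k = l then w else (W k)\<^sup>T *\<^sub>v y2 k)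
      - (vec_diag (z j) *\<^sub>v b j + y1 j + y2 j) \<in> carrier_vec (n k)"
    by (intro minus_carrier_vec)
  then show ?thesis
    using False by (simp add: slack_vec_def j_def)
qed

lemma slack_block_carrier:
  assumes "i \<le> l" "j \<le> l"
  shows "B i j \<in> carrier_mat (bdim n i) (bdim n j)"
proof -
  have off: "(W k)\<^sup>T * vec_diag (z k) \<in> carrier_mat (n k) (n (k + 1))" if "k \<in> {1..<l}" for k
    using W[OF that] vec_diag_carrier[OF that] by simp
  have diag: "vec_diag (z (i - 1)) \<in> carrier_mat (n i) (n i)" if "2 \<le> i"
    using vec_diag_carrier[of "i - 1"] that assms by (simp add: le_diff_conv2 less_diff_conv2)
  consider "i = 0" | "i \<noteq> 0" "j = 0" | "i = 1" "j = 1" | "2 \<le> i" "i = j"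
    | "i \<noteq> 0" "j = i + 1" | "j \<noteq> 0" "i = j + 1"
    | "i \<noteq> 0" "j \<noteq> 0" "i \<noteq> j" "j \<noteq> i + 1" "i \<noteq> j + 1"
    by linarith
  then show ?thesis
  proof cases
    case 5
    with off[of i] assms show ?thesis by (simp add: slack_block_def bdim_def)
  next
    case 6
    with off[of j] assms show ?thesis by (simp add: slack_block_def bdim_def)
  qed (use diag in \<open>auto simp: slack_block_def bdim_def\<close>)
qed

lemma slack_block_transpose:
  assumes "i \<le> l" "j \<le> l"
  shows "B j i = (B i j)\<^sup>T"
proof -
  have diag: "(vec_diag u)\<^sup>T = vec_diag u" for u
    by (intro eq_matI) (auto simp: vec_diag_def mat_diag_def)
  have smult: "(c \<cdot>\<^sub>m A)\<^sup>T = c \<cdot>\<^sub>m A\<^sup>T" for c :: real and A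
    by (intro eq_matI) auto
  have one: "(mat 1 1 f)\<^sup>T = mat 1 1 f" for f :: "nat \<times> nat \<Rightarrow> real"
    by (intro eq_matI) auto
  show ?thesis
    by (auto simp: slack_block_def Let_def diag smult one transpose_mat_of_rows transpose_mat_of_cols)
qed

lemma slack_carrier: "S \<in> carrier_mat (total l n + 1) (total l n + 1)"
  by (simp add: slack_def from_blocks_def)

lemma slack_symmetric: "S\<^sup>T = S"
proof -
  have "(from_blocks l n B)\<^sup>T = from_blocks l n B"
    using slack_block_carrier slack_block_transpose by (rule from_blocks_symmetric)
  moreover have "(c \<cdot>\<^sub>m A)\<^sup>T = c \<cdot>\<^sub>m A\<^sup>T" for c :: real and A
    by (intro eq_matI) auto
  ultimately show ?thesis
    by (simp add: slack_def)
qed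

text \<open>Regroups a sum over layers by transitions: \<open>y2 k\<close> occurs in
  \<open>s k\<close> through the transpose of \<open>W k\<close> and with opposite sign in
  \<open>s (k + 1)\<close>, and together these form part of one constraint residual.\<close>

lemma sum_slack_vec:
  assumes x: "\<And>k. k \<in> {1..l} \<Longrightarrow> x k \<in> carrier_vec (n k)"
  shows "(\<Sum>k = 1..l. s k \<bullet> x k)
    = w \<bullet> x l - 2 * y0 * (xh \<bullet> x 1)
      + (\<Sum>k = 1..<l. y2 k \<bullet> (W k *\<^sub>v x k) - (vec_diag (z k) *\<^sub>v b k) \<bullet> x (k + 1)
          - y1 k \<bullet> x (k + 1) - y2 k \<bullet> x (k + 1))"
proof -
  \<comment> \<open>\<open>a k\<close> is what layer \<open>k\<close> passes on, with the objective
    at the output layer; \<open>c k\<close> is what the transition from \<open>k\<close> subtracts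
    at layer \<open>k + 1\<close>. Putting the input-ball term into \<open>c 0\<close> makes the
    formula uniform in \<open>k\<close>.\<close>
  define a where "a k = (if k = l then w \<bullet> x l else y2 k \<bullet> (W k *\<^sub>v x k))" for k
  define c where "c k = (if k = 0 then 2 * y0 * (xh \<bullet> x 1) else (vec_diag (z k) *\<^sub>v b k) \<bullet> x (k + 1)
    + y1 k \<bullet> x (k + 1) + y2 k \<bullet> x (k + 1))" for k
  have summand: "s k \<bullet> x k = a k - c (k - 1)" if k: "k \<in> {1..l}" for k
  proof -
    have forward: "((W k)\<^sup>T *\<^sub>v y2 k) \<bullet> x k = y2 k \<bullet> (W k *\<^sub>v x k)" if "k < l"
      using transpose_vec_mult_scalar[of "W k" "n (k + 1)" "n k" "x k" "y2 k"] W[of k] x[of k] y2[of k] k that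
      by (simp add: comm_scalar_prod)
    show ?thesis
    proof (cases "k = 1")
      case True
      then show ?thesis
        using l forward x[of 1] xh W[of 1] y2[of 1]
        by (simp add: slack_vec_def a_def c_def minus_scalar_prod_distrib[of _ "n 1"])
    next
      case False
      define j where "j = k - 1"
      have j: "j \<in> {1..<l}" "k = j + 1" "j \<noteq> 0"
        using False k by (auto simp: j_def)
      have zb: "vec_diag (z j) *\<^sub>v b j \<in> carrier_vec (n (j + 1))"
        using vec_diag_carrier[OF j(1)] b[OF j(1)] by simp
      let ?u = "if k = l then w else (W k)\<^sup>T *\<^sub>v y2 k"
      have u: "?u \<in> carrier_vec (n (j + 1))"
        using w transpose_W_y2_carrier[of k] k j by auto
      have "s k = ?u - (vec_diag (z j) *\<^sub>v b j + y1 j + y2 j)"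
        using False by (simp add: slack_vec_def j_def)
      then have "s k \<bullet> x k = ?u \<bullet> x k - (vec_diag (z j) *\<^sub>v b j + y1 j + y2 j) \<bullet> x k"
        using minus_scalar_prod_distrib[OF u] zb y1[OF j(1)] y2[OF j(1)] x[OF k] j(2) by simp
      also have "?u \<bullet> x k = a k"
        using forward k by (auto simp: a_def)
      also have "(vec_diag (z j) *\<^sub>v b j + y1 j + y2 j) \<bullet> x k = c j"
        using zb y1[OF j(1)] y2[OF j(1)] x[OF k] j
        by (simp add: c_def add_scalar_prod_distrib[of _ "n (j + 1)"])
      finally show ?thesis
        by (simp add: j_def)
    qed
  qed
  have "(\<Sum>k = 1..l. s k \<bullet> x k) = (\<Sum>k = 1..l. a k) - (\<Sum>k = 1..l. c (k - 1))"
    by (simp add: summand sum_subtractf)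
  also have "(\<Sum>k = 1..l. a k) = (\<Sum>k = 1..<l. y2 k \<bullet> (W k *\<^sub>v x k)) + w \<bullet> x l"
    using l by (subst sum_split_last) (auto simp: a_def)
  also have "(\<Sum>k = 1..l. c (k - 1)) = 2 * y0 * (xh \<bullet> x 1)
      + (\<Sum>k = 1..<l. (vec_diag (z k) *\<^sub>v b k) \<bullet> x (k + 1) + y1 k \<bullet> x (k + 1) + y2 k \<bullet> x (k + 1))"
    using l by (subst sum_split_first) (auto simp: c_def)
  finally show ?thesis
    by (simp add: sum.distrib sum_subtractf)
qed

text \<open>\<open>S\<close> is the coefficient matrix of the Lagrangian: the pairing is the
  objective plus each multiplier times its residual, where \<open>z0\<close> belongs to
  \<open>1 - x0\<close> up to the constant \<open>z0\<close>. Keeping \<open>x0\<close> general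
  makes both sides linear in \<open>X\<close>.\<close>

lemma frob_slack:
  assumes X: "X \<in> carrier_mat (total l n + 1) (total l n + 1)" "X\<^sup>T = X"
    and x_def: "x = block_vec n X" and x0_def: "x0 = X $$ (0, 0)"
  shows "frob S X = w \<bullet> x l - z0 * x0
    + y0 * (mat_trace (block n X 1 1) - 2 * (x 1 \<bullet> xh) + (vnorm xh)\<^sup>2 * x0 - \<rho>\<^sup>2 * x0)
    + (\<Sum>k = 1..<l. y2 k \<bullet> (W k *\<^sub>v x k + x0 \<cdot>\<^sub>v b k - x (k + 1)) - y1 k \<bullet> x (k + 1)
        + z k \<bullet> diag_vec (block n X (k + 1) (k + 1) - W k * block n X k (k + 1) - outer (b k) (x (k + 1))))"
proof -
  define G where "G i j = frob (B i j) (block n X i j)" for i j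
  have x: "x k \<in> carrier_vec (n k)" if "1 \<le> k" for k
    using block_vec_carrier[of n X k] that by (simp add: x_def bdim_def)
  have blk: "block n X i j \<in> carrier_mat (n i) (n j)" if "1 \<le> i" "1 \<le> j" for i j
    using block_carrier[of n X i j] that by (simp add: bdim_def)
  have G_sym: "G j i = G i j" if "i \<le> l" "j \<le> l" for i j
  proof -
    have "G j i = frob (B i j)\<^sup>T (block n X i j)\<^sup>T"
      unfolding G_def slack_block_transpose[OF that] block_transpose[OF X that] ..
    also have "\<dots> = G i j"
      unfolding G_def using slack_block_carrier[OF that] block_carrier[of n X i j]
      by (intro frob_transpose) auto
    finally show ?thesis .
  qed
  have G_zero: "G i j = 0" if "1 \<le> i" "i + 1 < j" for i j
    using that by (simp add: G_def slack_block_def Let_def frob_def)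
  have G00: "G 0 0 = slack_corner l b xh \<rho> y0 y2 z0 * x0"
    by (simp add: G_def slack_block_def Let_def frob_def block_def bdim_def boff_def x0_def)
  have G0: "G 0 j = s j \<bullet> x j" if "j \<in> {1..l}" for j
  proof -
    have "B 0 j = mat_of_rows (bdim n j) [s j]"
      using that by (simp add: slack_block_def Let_def bdim_def)
    then show ?thesis
      unfolding G_def x_def using that slack_vec_carrier[OF that]
      using frob_row_block[of "s j" n j l X] X by (simp add: bdim_def)
  qed
  have G11: "G 1 1 = 2 * y0 * mat_trace (block n X 1 1)"
    using blk[of 1 1] by (simp add: G_def slack_block_def Let_def frob_smult frob_one)
  have Gd: "G (k + 1) (k + 1) = 2 * (z k \<bullet> diag_vec (block n X (k + 1) (k + 1)))" if "k \<in> {1..<l}" for k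
    using that z[OF that] blk[of "k + 1" "k + 1"]
    by (simp add: G_def slack_block_def Let_def frob_smult frob_diag[of _ "n (k + 1)"])
  have Go: "G k (k + 1) = - (z k \<bullet> diag_vec (W k * block n X k (k + 1)))" if "k \<in> {1..<l}" for k
    using that z[OF that] W[OF that] blk[of k "k + 1"]
    by (simp add: G_def slack_block_def Let_def frob_uminus frob_transpose_mult_diag[of _ "n (k + 1)" _ "n k"])
  \<comment> \<open>Doubling clears the factor 1/2 in \<open>slack\<close>.\<close>
  have "2 * frob S X = (\<Sum>i\<le>l. \<Sum>j\<le>l. G i j)"
    using frob_from_blocks[of l B n X] slack_block_carrier by (simp add: slack_def frob_smult G_def)
  also have "\<dots> = G 0 0 + 2 * (\<Sum>j = 1..l. G 0 j) + (\<Sum>j = 1..l. G j j) + 2 * (\<Sum>k = 1..<l. G k (k + 1))"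
    using G_sym G_zero by (rule sum_arrow_tridiagonal)
  also have "(\<Sum>j = 1..l. G j j) = G 1 1 + (\<Sum>k = 1..<l. G (k + 1) (k + 1))"
    using l by (intro sum_split_first) simp
  also have "(\<Sum>j = 1..l. G 0 j) = (\<Sum>k = 1..l. s k \<bullet> x k)"
    using G0 by (intro sum.cong) auto
  also have "\<dots> = w \<bullet> x l - 2 * y0 * (xh \<bullet> x 1)
      + (\<Sum>k = 1..<l. y2 k \<bullet> (W k *\<^sub>v x k) - (vec_diag (z k) *\<^sub>v b k) \<bullet> x (k + 1)
          - y1 k \<bullet> x (k + 1) - y2 k \<bullet> x (k + 1))"
    using x by (intro sum_slack_vec) simp
  also have "(\<Sum>k = 1..<l. G (k + 1) (k + 1)) = 2 * (\<Sum>k = 1..<l. z k \<bullet> diag_vec (block n X (k + 1) (k + 1)))"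
    unfolding sum_distrib_left using Gd by (intro sum.cong) auto
  also have "(\<Sum>k = 1..<l. G k (k + 1)) = - (\<Sum>k = 1..<l. z k \<bullet> diag_vec (W k * block n X k (k + 1)))"
    unfolding sum_negf[symmetric] using Go by (intro sum.cong) auto
  finally have frob: "frob S X = w \<bullet> x l - z0 * x0
    + y0 * (mat_trace (block n X 1 1) - 2 * (xh \<bullet> x 1) + (vnorm xh)\<^sup>2 * x0 - \<rho>\<^sup>2 * x0)
    + (\<Sum>k = 1..<l. x0 * (b k \<bullet> y2 k) + y2 k \<bullet> (W k *\<^sub>v x k) - (vec_diag (z k) *\<^sub>v b k) \<bullet> x (k + 1)
        - y1 k \<bullet> x (k + 1) - y2 k \<bullet> x (k + 1)
        + z k \<bullet> diag_vec (block n X (k + 1) (k + 1)) - z k \<bullet> diag_vec (W k * block n X k (k + 1)))"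
    by (simp add: G00 G11[unfolded One_nat_def] slack_corner_def sum.distrib sum_subtractf sum_distrib_left[symmetric] algebra_simps)
  \<comment> \<open>Within one transition, the terms with \<open>y2 k\<close> and those with
    \<open>z k\<close> combine into the residuals of their constraints.\<close>
  have summand: "x0 * (b k \<bullet> y2 k) + y2 k \<bullet> (W k *\<^sub>v x k) - (vec_diag (z k) *\<^sub>v b k) \<bullet> x (k + 1)
        - y1 k \<bullet> x (k + 1) - y2 k \<bullet> x (k + 1)
        + z k \<bullet> diag_vec (block n X (k + 1) (k + 1)) - z k \<bullet> diag_vec (W k * block n X k (k + 1))
    = y2 k \<bullet> (W k *\<^sub>v x k + x0 \<cdot>\<^sub>v b k - x (k + 1)) - y1 k \<bullet> x (k + 1)
        + z k \<bullet> diag_vec (block n X (k + 1) (k + 1) - W k * block n X k (k + 1) - outer (b k) (x (k + 1)))"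
    if k: "k \<in> {1..<l}" for k
  proof -
    let ?m = "n (k + 1)" and ?D = "block n X (k + 1) (k + 1)" and ?E = "W k * block n X k (k + 1)"
    have c: "x (k + 1) \<in> carrier_vec ?m" "W k *\<^sub>v x k \<in> carrier_vec ?m"
      "?D \<in> carrier_mat ?m ?m" "?E \<in> carrier_mat ?m ?m" "outer (b k) (x (k + 1)) \<in> carrier_mat ?m ?m"
      using x[of k] x[of "k + 1"] W[OF k] b[OF k] blk[of "k + 1" "k + 1"] blk[of k "k + 1"] k
      by (auto simp: outer_def)
    have "diag_vec (?D - ?E - outer (b k) (x (k + 1)))
        = diag_vec ?D - diag_vec ?E - diag_vec (outer (b k) (x (k + 1)))"
      using c by (simp add: diag_vec_minus[of _ ?m] minus_carrier_mat)
    then have "z k \<bullet> diag_vec (?D - ?E - outer (b k) (x (k + 1)))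
        = z k \<bullet> diag_vec ?D - z k \<bullet> diag_vec ?E - (vec_diag (z k) *\<^sub>v b k) \<bullet> x (k + 1)"
      using c z[OF k] b[OF k] diag_vec_carrier[OF c(3)] diag_vec_carrier[OF c(4)] diag_vec_carrier[OF c(5)]
      by (simp add: scalar_prod_minus_distrib[of _ ?m] diag_vec_outer[of _ ?m])
    moreover have "y2 k \<bullet> (W k *\<^sub>v x k + x0 \<cdot>\<^sub>v b k - x (k + 1))
        = y2 k \<bullet> (W k *\<^sub>v x k) + x0 * (b k \<bullet> y2 k) - y2 k \<bullet> x (k + 1)"
      using c y2[OF k] b[OF k] comm_scalar_prod[OF b[OF k] y2[OF k]]
      by (simp add: scalar_prod_minus_distrib[of _ ?m] scalar_prod_add_distrib[of _ ?m])
    ultimately show ?thesis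
      by simp
  qed
  have "xh \<bullet> x 1 = x 1 \<bullet> xh"
    using xh x[of 1] by (simp add: comm_scalar_prod[of _ "n 1"])
  then show ?thesis
    unfolding frob by (simp only: sum.cong[OF refl summand])
qed

end

section \<open>The duality bound\<close>

lemma scalar_prod_nonneg:
  fixes u v :: "real vec"
  assumes "0\<^sub>v m \<le> u" "0\<^sub>v m \<le> v"
  shows "0 \<le> u \<bullet> v"
  using assms by (auto simp: scalar_prod_def less_eq_vec_def intro!: sum_nonneg)

theorem proposition3p1:
  fixes l :: nat and n :: "nat \<Rightarrow> nat"
    and W :: "nat \<Rightarrow> real mat" and b :: "nat \<Rightarrow> real vec" and w xh :: "real vec"
    and \<rho> R :: real and r :: nat and Xs :: "real mat"
    and y0 :: real and y1 y2 :: "nat \<Rightarrow> real vec" and z0 :: real and z :: "nat \<Rightarrow> real vec"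
  assumes "2 \<le> l"
    and "\<And>k. k \<in> {1..<l} \<Longrightarrow> W k \<in> carrier_mat (n (k + 1)) (n k)"
    and "\<And>k. k \<in> {1..<l} \<Longrightarrow> b k \<in> carrier_vec (n (k + 1))"
    and "w \<in> carrier_vec (n l)"
    and "xh \<in> carrier_vec (n 1)"
    and "0 < R"
    and "sdp_value l n W b w xh \<rho> R 1 = attack_value l n W b w xh \<rho>"
    and "1 \<le> r"
    and "sdp_solution l n W b w xh \<rho> R r Xs"
    and "mat_trace Xs < R\<^sup>2"
    and "\<And>k. k \<in> {1..<l} \<Longrightarrow> y1 k \<in> carrier_vec (n (k + 1))"
    and "\<And>k. k \<in> {1..<l} \<Longrightarrow> y2 k \<in> carrier_vec (n (k + 1))"
    and "\<And>k. k \<in> {1..<l} \<Longrightarrow> z k \<in> carrier_vec (n (k + 1))"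
    and "0 \<le> y0"
    and "\<And>k. k \<in> {1..<l} \<Longrightarrow> 0\<^sub>v (n (k + 1)) \<le> y1 k"
    and "\<And>k. k \<in> {1..<l} \<Longrightarrow> 0\<^sub>v (n (k + 1)) \<le> y2 k"
  shows "attack_value l n W b w xh \<rho> \<ge> sdp_value l n W b w xh \<rho> R r \<and>
         sdp_value l n W b w xh \<rho> R r
           \<ge> ereal (z0 + R\<^sup>2 * min 0 (lambda_min (slack l n W b w xh \<rho> y0 y1 y2 z0 z)))"
proof
  have "sdp_feasible l n W b xh \<rho> R 1 \<subseteq> sdp_feasible l n W b xh \<rho> R r"
    using assms(8) by (auto simp: sdp_feasible_def Let_def)
  then show "sdp_value l n W b w xh \<rho> R r \<le> attack_value l n W b w xh \<rho>"
    unfolding assms(7)[symmetric] sdp_value_def by (rule INF_superset_mono) simp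
next
  interpret multipliers l n W b w xh \<rho> y0 y1 y2 z0 z
    by unfold_locales (fact assms)+
  let ?\<mu> = "min 0 (lambda_min S)"
  show "ereal (z0 + R\<^sup>2 * ?\<mu>) \<le> sdp_value l n W b w xh \<rho> R r"
    unfolding sdp_value_def
  proof (rule INF_greatest)
    fix X assume feasible: "X \<in> sdp_feasible l n W b xh \<rho> R r"
    define x where "x = block_vec n X"
    \<comment> \<open>The factors 1 stay in place so that the terms match \<open>frob_slack\<close>
      at \<open>x0 = 1\<close>.\<close>
    have psd: "psd (total l n + 1) X" and x0: "X $$ (0, 0) = 1" and trace: "mat_trace X \<le> R\<^sup>2"
      and ball: "mat_trace (block n X 1 1) - 2 * (x 1 \<bullet> xh) + (vnorm xh)\<^sup>2 * 1 \<le> \<rho>\<^sup>2 * 1"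
      and layers: "\<And>k. k \<in> {1..<l} \<Longrightarrow> 0\<^sub>v (n (k + 1)) \<le> x (k + 1)"
        "\<And>k. k \<in> {1..<l} \<Longrightarrow> W k *\<^sub>v x k + 1 \<cdot>\<^sub>v b k \<le> x (k + 1)"
        "\<And>k. k \<in> {1..<l} \<Longrightarrow> diag_vec (block n X (k + 1) (k + 1) - W k * block n X k (k + 1)
          - outer (b k) (x (k + 1))) = 0\<^sub>v (n (k + 1))"
      using feasible unfolding sdp_feasible_def Let_def x_def by auto
    have X: "X \<in> carrier_mat (total l n + 1) (total l n + 1)" "X\<^sup>T = X"
      using psd by (auto simp: psd_def)
    \<comment> \<open>The nonnegative \<open>y1 k\<close> and \<open>y2 k\<close> weight
      inequalities, while \<open>z k\<close> may have any sign because it weights an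
      equality.\<close>
    have layer: "y2 k \<bullet> (W k *\<^sub>v x k + 1 \<cdot>\<^sub>v b k - x (k + 1)) - y1 k \<bullet> x (k + 1)
        + z k \<bullet> diag_vec (block n X (k + 1) (k + 1) - W k * block n X k (k + 1)
            - outer (b k) (x (k + 1))) \<le> 0" if k: "k \<in> {1..<l}" for k
    proof -
      have "W k *\<^sub>v x k + 1 \<cdot>\<^sub>v b k - x (k + 1) \<in> carrier_vec (n (k + 1))"
        using layers(1)[OF k] by (auto simp: less_eq_vec_def intro: carrier_vecI)
      moreover have "0\<^sub>v (n (k + 1)) \<le> - (W k *\<^sub>v x k + 1 \<cdot>\<^sub>v b k - x (k + 1))"
        using layers(1,2)[OF k] b[OF k] by (auto simp: less_eq_vec_def)
      ultimately have "y2 k \<bullet> (W k *\<^sub>v x k + 1 \<cdot>\<^sub>v b k - x (k + 1)) \<le> 0"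
        using scalar_prod_nonneg[OF assms(16)[OF k]] y2[OF k]
        by (metis carrier_vecD neg_0_le_iff_le scalar_prod_uminus_right)
      with scalar_prod_nonneg[OF assms(15)[OF k] layers(1)[OF k]] show ?thesis
        using z[OF k] unfolding layers(3)[OF k] by simp
    qed
    \<comment> \<open>The minimum with 0 serves here: a nonpositive factor reverses the upper bound
      on the trace. The next step replaces it by \<open>lambda_min S\<close>, using that the trace
      is nonnegative.\<close>
    have "R\<^sup>2 * ?\<mu> \<le> ?\<mu> * mat_trace X"
      using mult_left_mono_neg[OF trace, of ?\<mu>] by (simp add: mult.commute)
    also have "\<dots> \<le> lambda_min S * mat_trace X"
      using psd_trace_nonneg[OF psd] by (intro mult_right_mono) auto
    also have "\<dots> \<le> frob S X"
      using slack_carrier slack_symmetric psd by (intro lambda_min_trace_le) auto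
    also have "\<dots> \<le> w \<bullet> x l - z0"
    proof -
      have "y0 * (mat_trace (block n X 1 1) - 2 * (x 1 \<bullet> xh) + (vnorm xh)\<^sup>2 * 1 - \<rho>\<^sup>2 * 1) \<le> 0"
        using assms(14) ball by (intro mult_nonneg_nonpos) auto
      moreover have "(\<Sum>k = 1..<l. y2 k \<bullet> (W k *\<^sub>v x k + 1 \<cdot>\<^sub>v b k - x (k + 1)) - y1 k \<bullet> x (k + 1)
        + z k \<bullet> diag_vec (block n X (k + 1) (k + 1) - W k * block n X k (k + 1)
            - outer (b k) (x (k + 1)))) \<le> 0"
        by (intro sum_nonpos layer)
      ultimately show ?thesis
        unfolding frob_slack[OF X x_def x0[symmetric]] by linarith
    qed
    finally show "ereal (z0 + R\<^sup>2 * ?\<mu>) \<le> ereal (sdp_objective l n w X)"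
      by (simp add: sdp_objective_def x_def)
  qed
qed

end
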